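(* Let $d\ge 2$ be an integer, let $\tau>0$ and $\alpha\in\mathbb{R}$. For every smooth compactly supported function $u$ on $\Sigma_\tau\cong\mathbb{R}^d$, $$\tau^{\frac{1}{d-1}} \int_{\Sigma_\tau} w_\tau^{1 + \alpha \frac{d}{d-1}} |u|^{\frac{d}{d-1}} \, \mathrm{dvol} \;\le\; \prod_{i = 1}^d \left( \int_{\Sigma_\tau} \bigl( w_\tau^\alpha |L^i u| + |\alpha|\, w_\tau^\alpha |u| \bigr)\, \mathrm{dvol} \right)^{\frac{1}{d-1}}.$$
   Context: For $\tau>0$ let $\Sigma_\tau=\{(t,x)\in\mathbb{R}^{1+d}: t^2-|x|^2=\tau^2,\ t>0\}$, parametrized by $x\in\mathbb{R}^d$ via $x\mapsto(\sqrt{\tau^2+|x|^2},x)$, and let $w_\tau(x)=\sqrt{\tau^2+|x|^2}$. The volume form induced from the Minkowski metric is $\mathrm{dvol}=\frac{\tau}{w_\tau}\,dx^1\cdots dx^d$ in this parametrization. The Lorentz boosts $L^i=x^i\partial_t+t\partial_{x^i}$ ($i=1,\dots,d$) are tangent to $\Sigma_\tau$ and in this parametrization act as $L^i=w_\tau\partial_{x^i}$. *)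

theory Defs
  imports "HOL-Analysis.Analysis"
begin

definition hyperboloid :: "real \<Rightarrow> (real \<times> (real ^ 'n::finite)) set" where
  "hyperboloid \<tau> = {(t, x). t\<^sup>2 - (norm x)\<^sup>2 = \<tau>\<^sup>2 \<and> t > 0}"

definition hyp_weight :: "real \<Rightarrow> real ^ 'n::finite \<Rightarrow> real" where
  "hyp_weight \<tau> x = sqrt (\<tau>\<^sup>2 + (norm x)\<^sup>2)"

definition hyp_param :: "real \<Rightarrow> real ^ 'n::finite \<Rightarrow> real \<times> (real ^ 'n)" where
  "hyp_param \<tau> x = (hyp_weight \<tau> x, x)"

text \<open>The volume measure of the hyperboloid, and all functions on it, are expressed
  in the global parametrization \<^const>\<open>hyp_param\<close>.\<close>

definition hyp_vol :: "real \<Rightarrow> (real ^ 'n::finite) measure" where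
  "hyp_vol \<tau> = density lborel (\<lambda>x. ennreal (\<tau> / hyp_weight \<tau> x))"

definition partial_deriv :: "'n::finite \<Rightarrow> (real ^ 'n \<Rightarrow> real) \<Rightarrow> real ^ 'n \<Rightarrow> real" where
  "partial_deriv i f x = frechet_derivative f (at x) (axis i 1)"

text \<open>The lemma \<open>hyp_boost_eq_ambient\<close> below relates this to the vector field
  \<open>x\<^sup>i \<partial>\<^sub>t + t \<partial>\<^sub>i\<close> on Minkowski space.\<close>

definition hyp_boost :: "real \<Rightarrow> 'n::finite \<Rightarrow> (real ^ 'n \<Rightarrow> real) \<Rightarrow> real ^ 'n \<Rightarrow> real" where
  "hyp_boost \<tau> i f x = hyp_weight \<tau> x * partial_deriv i f x"

fun times_cont_diff :: "nat \<Rightarrow> (real ^ 'n::finite \<Rightarrow> real) \<Rightarrow> bool" where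
  "times_cont_diff 0 f \<longleftrightarrow> continuous_on UNIV f"
| "times_cont_diff (Suc k) f \<longleftrightarrow>
     (\<forall>x. f differentiable (at x)) \<and> (\<forall>i. times_cont_diff k (partial_deriv i f))"

definition smooth_fun :: "(real ^ 'n::finite \<Rightarrow> real) \<Rightarrow> bool" where
  "smooth_fun f \<longleftrightarrow> (\<forall>k. times_cont_diff k f)"

definition compact_support :: "(real ^ 'n::finite \<Rightarrow> real) \<Rightarrow> bool" where
  "compact_support f \<longleftrightarrow> compact (closure {x. f x \<noteq> 0})"

lemma bij_betw_hyp_param:
  assumes "\<tau> > 0"
  shows "bij_betw (hyp_param \<tau>) UNIV (hyperboloid \<tau>)"
proof -
  have pos: "\<tau>\<^sup>2 + (norm x)\<^sup>2 > 0" for x :: "real ^ 'n"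
    using assms by (simp add: add_pos_nonneg)
  have "p \<in> range (hyp_param \<tau>)" if "p \<in> hyperboloid \<tau>" for p :: "real \<times> (real ^ 'n)"
  proof -
    obtain t x where p: "p = (t, x)" by (cases p)
    with that have "t\<^sup>2 = \<tau>\<^sup>2 + (norm x)\<^sup>2" "t > 0"
      by (auto simp: hyperboloid_def)
    then have "hyp_weight \<tau> x = t"
      unfolding hyp_weight_def by (metis real_sqrt_abs abs_of_pos)
    then show ?thesis by (auto simp: p hyp_param_def image_iff)
  qed
  moreover have "hyp_param \<tau> x \<in> hyperboloid \<tau>" for x :: "real ^ 'n"
    using pos[of x] by (simp add: hyperboloid_def hyp_param_def hyp_weight_def)
  ultimately show ?thesis
    by (auto simp: bij_betw_def inj_on_def hyp_param_def)
qed

lemma hyp_boost_eq_ambient: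
  fixes F :: "real \<times> (real ^ 'n::finite) \<Rightarrow> real"
  assumes "\<tau> > 0" and "F differentiable (at (hyp_param \<tau> x))"
  shows "hyp_boost \<tau> i (F \<circ> hyp_param \<tau>) x =
    frechet_derivative F (at (hyp_param \<tau> x)) (x $ i, hyp_weight \<tau> x *\<^sub>R axis i 1)"
proof -
  define w where "w = hyp_weight \<tau> x"
  have pos: "\<tau>\<^sup>2 + x \<bullet> x > 0"
    using assms by (simp add: add_pos_nonneg)
  then have w: "w > 0"
    by (simp add: w_def hyp_weight_def power2_norm_eq_inner)
  have hw: "hyp_weight \<tau> = (\<lambda>y :: real ^ 'n. sqrt (\<tau>\<^sup>2 + y \<bullet> y))"
    by (simp add: fun_eq_iff hyp_weight_def power2_norm_eq_inner)
  have "(hyp_weight \<tau> has_derivative (\<lambda>h. (x \<bullet> h) / w)) (at x)"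
    unfolding hw w_def using pos
    by (auto intro!: derivative_eq_intros simp: fun_eq_iff field_simps inner_commute)
  then have 1: "(hyp_param \<tau> has_derivative (\<lambda>h. ((x \<bullet> h) / w, h))) (at x)"
    unfolding hyp_param_def[abs_def] by (intro has_derivative_Pair has_derivative_ident)
  let ?D = "frechet_derivative F (at (hyp_param \<tau> x))"
  have 2: "(F has_derivative ?D) (at (hyp_param \<tau> x))"
    using assms(2) by (simp add: frechet_derivative_works)
  have lin: "linear ?D"
    using assms(2) by (rule linear_frechet_derivative)
  have "frechet_derivative (F \<circ> hyp_param \<tau>) (at x) = ?D \<circ> (\<lambda>h. ((x \<bullet> h) / w, h))"
    using frechet_derivative_at[OF diff_chain_at[OF 1 2]] by simp
  then have "hyp_boost \<tau> i (F \<circ> hyp_param \<tau>) x = w *\<^sub>R ?D ((x $ i) / w, axis i 1)"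
    by (simp add: hyp_boost_def partial_deriv_def w_def inner_axis)
  also have "\<dots> = ?D (w *\<^sub>R ((x $ i) / w, axis i 1))"
    using linear_scale[OF lin] by metis
  also have "w *\<^sub>R ((x $ i) / w, axis i 1) = (x $ i, w *\<^sub>R axis i 1)"
    using w by simp
  finally show ?thesis unfolding w_def .
qed

end

theory Submission
  imports Defs
begin

text \<open>
  Write \<open>w\<close> for the weight. In the parametrization by \<open>x\<close> the factors of \<open>w\<close> produced
  by the boosts and by the volume form can be absorbed: with \<open>v = w\<^sup>\<alpha> u\<close>, \<open>q = d/(d-1)\<close> and
  \<open>G\<^sub>i = w\<^sup>\<alpha> |\<partial>\<^sub>i u| + |\<alpha>| w\<^bsup>\<alpha>-1\<^esup> |u|\<close>, the left side is
  \<open>\<tau>\<^sup>q\<close> times the Lebesgue integral of \<open>|v|\<^sup>q\<close>, and the right side is \<open>\<tau>\<^sup>q\<close> times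
  the product of the numbers \<open>(\<integral> G\<^sub>i dx)\<^bsup>1/(d-1)\<^esup>\<close>. Since \<open>\<partial>\<^sub>i w = x\<^sub>i / w\<close> has modulus at
  most \<open>1\<close>, the Leibniz rule gives \<open>|\<partial>\<^sub>i v| \<le> G\<^sub>i\<close>. The claim is therefore the classical
  Gagliardo--Nirenberg inequality for \<open>v\<close> (lemma \<open>Gagliardo_Nirenberg\<close>), with the product over
  the directions kept instead of being bounded by the full gradient.

  That inequality comes from two facts. The fundamental theorem of calculus bounds \<open>|v x|\<close>, for
  every direction \<open>i\<close>, by the integral of \<open>|\<partial>\<^sub>i v|\<close> along the line through \<open>x\<close> in that direction
  (\<open>abs_le_nn_integral_abs_deriv\<close>); taking the product of the \<open>(d-1)\<close>-th roots of these \<open>d\<close> bounds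
  yields \<open>|v|\<^sup>q\<close>. The integral of such a product of line integrals is then estimated by integrating
  out one variable at a time (\<open>marginal_prod_le\<close>): the factor that belongs to the current variable is
  already constant in it, and the remaining \<open>d-1\<close> factors are handled by Hoelder's inequality with
  \<open>d-1\<close> equal exponents.

  The measure theory takes place in the extended nonnegative reals, so that Tonelli's theorem applies
  and no integrability of intermediate integrals has to be tracked.
\<close>

section \<open>Hoelder's inequality with equal exponents\<close>

text \<open>The value at \<open>\<infinity>\<close> is the one that makes the power continuous and monotone for
  exponents \<open>p > 0\<close>.\<close>

definition ennreal_powr :: "real \<Rightarrow> ennreal \<Rightarrow> ennreal" where
  "ennreal_powr p x = (if x = top then top else ennreal (enn2real x powr p))"

lemma ennreal_powr_ennreal [simp]: "0 \<le> a \<Longrightarrow> ennreal_powr p (ennreal a) = ennreal (a powr p)"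
  by (simp add: ennreal_powr_def)

lemma ennreal_powr_top [simp]: "ennreal_powr p top = top"
  by (simp add: ennreal_powr_def)

lemma ennreal_powr_0 [simp]: "ennreal_powr p 0 = 0"
  by (simp add: ennreal_powr_def)

lemma ennreal_powr_eq_0_iff [simp]: "ennreal_powr p x = 0 \<longleftrightarrow> x = 0"
  by (cases x) (simp_all add: ennreal_eq_0_iff)

lemma ennreal_powr_mono: "0 \<le> p \<Longrightarrow> x \<le> y \<Longrightarrow> ennreal_powr p x \<le> ennreal_powr p y"
  by (cases x; cases y) (auto simp: powr_mono2 top_unique)

lemma measurable_ennreal_powr [measurable (raw)]:
  assumes [measurable]: "f \<in> borel_measurable M"
  shows "(\<lambda>x. ennreal_powr p (f x)) \<in> borel_measurable M"
  unfolding ennreal_powr_def by measurable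

text \<open>The inequality between the geometric and the arithmetic mean for the ratios
  \<open>h i / c i\<close>, multiplied by the geometric mean of the \<open>c i\<close>. The right side is linear in \<open>h\<close>,
  hence it can be integrated termwise.\<close>

lemma weighted_AM_GM_ennreal:
  fixes h :: "'k \<Rightarrow> ennreal" and c :: "'k \<Rightarrow> real"
  assumes K: "finite K" "K \<noteq> {}" and c: "\<And>i. i \<in> K \<Longrightarrow> 0 < c i"
  shows "(\<Prod>i\<in>K. ennreal_powr (1 / card K) (h i)) \<le>
    (\<Prod>i\<in>K. ennreal_powr (1 / card K) (ennreal (c i))) * (\<Sum>i\<in>K. ennreal (1 / (card K * c i)) * h i)"
    (is "?L \<le> ?C * ?S")
proof (cases "\<exists>j\<in>K. h j = top")
  case True
  then obtain j where j: "j \<in> K" "h j = top" by auto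
  have n: "real (card K) > 0" using K by (simp add: card_gt_0_iff)
  have "ennreal (1 / (card K * c j)) * h j = top"
    using c[OF j(1)] n j by (simp add: ennreal_mult_top ennreal_eq_0_iff not_le)
  then have "?S = top"
    using K j by (simp add: sum.remove[OF K(1) j(1)])
  moreover have "?C \<noteq> 0"
    using c K(1) by (simp add: ennreal_eq_0_iff not_le del: ennreal_powr_ennreal)
  ultimately have "?C * ?S = top"
    unfolding ennreal_mult_eq_top_iff by blast
  then show ?thesis by (simp only: top_greatest)
next
  case False
  define r where "r i = enn2real (h i)" for i
  have r: "0 \<le> r i" for i by (simp add: r_def)
  have h: "h i = ennreal (r i)" if "i \<in> K" for i
    using False that by (auto simp: r_def less_top)
  have c0: "0 \<le> c i" if "i \<in> K" for i using c[OF that] by simp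
  let ?p = "1 / real (card K)"
  have "(\<Prod>i\<in>K. r i powr ?p) = (\<Prod>i\<in>K. c i powr ?p * (r i / c i) powr ?p)"
    using c by (intro prod.cong refl) (auto simp: powr_mult[symmetric] less_imp_le r less_imp_neq[symmetric])
  also have "\<dots> = (\<Prod>i\<in>K. c i powr ?p) * (\<Prod>i\<in>K. (r i / c i) powr ?p)"
    by (rule prod.distrib)
  also have "(\<Prod>i\<in>K. (r i / c i) powr ?p) = (\<Prod>i\<in>K. r i / c i) powr ?p"
    using c0 r by (simp add: prod_powr_distrib)
  also have "(\<Prod>i\<in>K. c i powr ?p) * \<dots> \<le> (\<Prod>i\<in>K. c i powr ?p) * (\<Sum>i\<in>K. (r i / c i) / card K)"
    using K r c0 by (intro mult_left_mono arith_geom_mean prod_nonneg) auto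
  also have "(\<Sum>i\<in>K. (r i / c i) / card K) = (\<Sum>i\<in>K. 1 / (card K * c i) * r i)"
    by (simp add: field_simps)
  finally have *: "(\<Prod>i\<in>K. r i powr ?p)
      \<le> (\<Prod>i\<in>K. c i powr ?p) * (\<Sum>i\<in>K. 1 / (card K * c i) * r i)" .
  have "?L = ennreal (\<Prod>i\<in>K. r i powr ?p)"
    using r by (simp add: h prod_ennreal cong: prod.cong)
  also have "\<dots> \<le> ennreal ((\<Prod>i\<in>K. c i powr ?p) * (\<Sum>i\<in>K. 1 / (card K * c i) * r i))"
    by (rule ennreal_leI[OF *])
  also have "\<dots> = ennreal (\<Prod>i\<in>K. c i powr ?p) * ennreal (\<Sum>i\<in>K. 1 / (card K * c i) * r i)"
    using c0 r by (intro ennreal_mult prod_nonneg sum_nonneg) auto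
  also have "ennreal (\<Prod>i\<in>K. c i powr ?p) = ?C"
    using c0 by (simp add: prod_ennreal cong: prod.cong)
  also have "ennreal (\<Sum>i\<in>K. 1 / (card K * c i) * r i) = ?S"
    using c0 r by (subst sum_ennreal[symmetric])
      (auto simp: h ennreal_mult[symmetric] intro!: sum.cong)
  finally show ?thesis .
qed

text \<open>Unless some integral degenerates, the constants in the weighted mean inequality are
  chosen as \<open>c i = \<integral> h i\<close>; each term of the integrated sum then equals \<open>1 / card K\<close> and the sum
  is \<open>1\<close>.\<close>

lemma nn_integral_prod_le_prod_nn_integral:
  fixes h :: "'k \<Rightarrow> 'a \<Rightarrow> ennreal"
  assumes K: "finite K" "K \<noteq> {}" and h[measurable]: "\<And>i. i \<in> K \<Longrightarrow> h i \<in> borel_measurable M"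
  shows "(\<integral>\<^sup>+x. (\<Prod>i\<in>K. ennreal_powr (1 / card K) (h i x)) \<partial>M) \<le> (\<Prod>i\<in>K. ennreal_powr (1 / card K) (\<integral>\<^sup>+x. h i x \<partial>M))"
    (is "?L \<le> ?R")
proof -
  consider j where "j \<in> K" "(\<integral>\<^sup>+x. h j x \<partial>M) = 0"
    | j where "j \<in> K" "(\<integral>\<^sup>+x. h j x \<partial>M) = top" "\<forall>i\<in>K. (\<integral>\<^sup>+x. h i x \<partial>M) \<noteq> 0"
    | "\<forall>i\<in>K. (\<integral>\<^sup>+x. h i x \<partial>M) \<noteq> 0 \<and> (\<integral>\<^sup>+x. h i x \<partial>M) \<noteq> top"
    by blast
  then show ?thesis
  proof cases
    case 1
    then have "AE x in M. h j x = 0"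
      by (subst (asm) nn_integral_0_iff_AE) auto
    then have "AE x in M. (\<Prod>i\<in>K. ennreal_powr (1 / card K) (h i x)) = 0"
      by eventually_elim (use 1 K in auto)
    then have "?L = (\<integral>\<^sup>+x. 0 \<partial>M)"
      by (rule nn_integral_cong_AE)
    then show ?thesis by simp
  next
    case 2
    then have "?R = top"
      using K by (auto simp: ennreal_prod_eq_top intro!: bexI[of _ j])
    then show ?thesis by simp
  next
    case 3
    define c where "c i = enn2real (\<integral>\<^sup>+x. h i x \<partial>M)" for i
    have I: "(\<integral>\<^sup>+x. h i x \<partial>M) = ennreal (c i)" if "i \<in> K" for i
      using 3 that by (auto simp: c_def less_top)
    have c: "0 < c i" if "i \<in> K" for i
      using 3 that by (auto simp: c_def enn2real_positive_iff zero_less_iff_neq_zero less_top)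
    have n: "real (card K) > 0" using K by (simp add: card_gt_0_iff)
    let ?C = "\<Prod>i\<in>K. ennreal_powr (1 / card K) (ennreal (c i))"
    have "?L \<le> (\<integral>\<^sup>+x. ?C * (\<Sum>i\<in>K. ennreal (1 / (card K * c i)) * h i x) \<partial>M)"
      by (intro nn_integral_mono weighted_AM_GM_ennreal K c)
    also have "\<dots> = ?C * (\<Sum>i\<in>K. ennreal (1 / (card K * c i)) * (\<integral>\<^sup>+x. h i x \<partial>M))"
      by (simp add: nn_integral_cmult nn_integral_sum)
    also have "(\<Sum>i\<in>K. ennreal (1 / (card K * c i)) * (\<integral>\<^sup>+x. h i x \<partial>M)) = (\<Sum>i\<in>K. ennreal (1 / card K))"
    proof (intro sum.cong refl)
      fix i assume "i \<in> K"
      from c[OF this] n show "ennreal (1 / (card K * c i)) * (\<integral>\<^sup>+x. h i x \<partial>M) = ennreal (1 / card K)"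
        by (simp add: I[OF \<open>i \<in> K\<close>] ennreal_mult[symmetric])
    qed
    also have "\<dots> = 1"
      using n by (simp add: sum_ennreal del: sum_constant) simp
    also have "?C = ?R" by (simp add: I cong: prod.cong)
    finally show ?thesis by simp
  qed
qed

section \<open>Integrating out the variables of a product measure\<close>

context product_sigma_finite
begin

text \<open>The variables in \<open>J\<close> are integrated out, but the result is kept as a function of all
  variables, constant in those of \<open>J\<close>. Marginals for different \<open>J\<close> thus live on the same space and
  can be multiplied.\<close>

definition marginal :: "'i set \<Rightarrow> (('i \<Rightarrow> 'a) \<Rightarrow> ennreal) \<Rightarrow> ('i \<Rightarrow> 'a) \<Rightarrow> ennreal" where
  "marginal J f x = (\<integral>\<^sup>+y. f (override_on x y J) \<partial>Pi\<^sub>M J M)"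

lemma measurable_override_on:
  assumes "J \<subseteq> I"
  shows "(\<lambda>p. override_on (fst p) (snd p) J) \<in> measurable (Pi\<^sub>M I M \<Otimes>\<^sub>M Pi\<^sub>M J M) (Pi\<^sub>M I M)"
proof (rule measurable_PiM_single')
  fix i assume i: "i \<in> I"
  show "(\<lambda>p. override_on (fst p) (snd p) J i) \<in> measurable (Pi\<^sub>M I M \<Otimes>\<^sub>M Pi\<^sub>M J M) (M i)"
    using i by (cases "i \<in> J") (simp_all add: override_on_def)
next
  show "(\<lambda>p. override_on (fst p) (snd p) J)
      \<in> space (Pi\<^sub>M I M \<Otimes>\<^sub>M Pi\<^sub>M J M) \<rightarrow> (\<Pi>\<^sub>E i\<in>I. space (M i))"
    using assms
    by (auto simp: space_pair_measure space_PiM PiE_iff override_on_def extensional_def)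
qed

lemma measurable_marginal:
  assumes "finite J" "J \<subseteq> I" and f[measurable]: "f \<in> borel_measurable (Pi\<^sub>M I M)"
  shows "marginal J f \<in> borel_measurable (Pi\<^sub>M I M)"
proof -
  interpret J: finite_product_sigma_finite M J
    by standard (rule assms)
  note measurable_override_on[OF assms(2), measurable]
  show ?thesis
    unfolding marginal_def[abs_def]
    by (rule J.borel_measurable_nn_integral) (simp add: case_prod_beta)
qed

lemma marginal_empty: "marginal {} f x = f x"
  by (simp add: marginal_def PiM_empty nn_integral_count_space_finite)

text \<open>Tonelli's theorem. The new variable is the outermost one, so that an induction
  hypothesis on the inner marginal can be used under the integral.\<close>

lemma marginal_insert:
  assumes J: "finite J" "j \<notin> J" "insert j J \<subseteq> I"
    and f[measurable]: "f \<in> borel_measurable (Pi\<^sub>M I M)" and x: "x \<in> space (Pi\<^sub>M I M)"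
  shows "marginal (insert j J) f x = (\<integral>\<^sup>+t. marginal J f (x(j := t)) \<partial>M j)"
proof -
  note measurable_override_on[OF J(3), measurable]
  have [measurable]: "(\<lambda>y. override_on x y (insert j J)) \<in> measurable (Pi\<^sub>M (insert j J) M) (Pi\<^sub>M I M)"
    using measurable_compose[OF measurable_Pair1'[OF x] measurable_override_on[OF J(3)]] by simp
  have "override_on x (y(j := t)) (insert j J) = override_on (x(j := t)) y J" for y t
    using J(2) by (auto simp: override_on_def fun_eq_iff)
  then show ?thesis
    unfolding marginal_def by (subst product_nn_integral_insert_rev[OF J(1,2)]) simp_all
qed

lemma marginal_update: "j \<in> J \<Longrightarrow> marginal J f (x(j := t)) = marginal J f x"
  unfolding marginal_def by (intro nn_integral_cong arg_cong[where f = f]) (auto simp: override_on_def fun_eq_iff)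

lemma fun_upd_in_space_PiM:
  "x \<in> space (Pi\<^sub>M I M) \<Longrightarrow> j \<in> I \<Longrightarrow> t \<in> space (M j) \<Longrightarrow> x(j := t) \<in> space (Pi\<^sub>M I M)"
  by (auto simp: space_PiM PiE_iff extensional_def)

text \<open>Induction on the set \<open>J\<close> of variables already integrated out. The function attached
  to the direction \<open>i\<close> has lost the variable \<open>i\<close> from the outset. Hence, when a further variable
  \<open>j\<close> is integrated, the factor with \<open>i = j\<close> does not depend on it and comes out of the
  integral, which leaves exactly \<open>card I - 1\<close> factors, as many as Hoelder's inequality with
  exponent \<open>1 / (card I - 1)\<close> admits.\<close>

lemma marginal_prod_le:
  assumes I: "finite I" "card I \<ge> 2"
    and G: "\<And>i. i \<in> I \<Longrightarrow> G i \<in> borel_measurable (Pi\<^sub>M I M)"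
    and J: "J \<subseteq> I" and x: "x \<in> space (Pi\<^sub>M I M)"
  defines "p \<equiv> 1 / real (card I - 1)"
  shows "marginal J (\<lambda>x. \<Prod>i\<in>I. ennreal_powr p (marginal {i} (G i) x)) x
    \<le> (\<Prod>i\<in>I. ennreal_powr p (marginal (insert i J) (G i) x))"
proof -
  define F where "F x = (\<Prod>i\<in>I. ennreal_powr p (marginal {i} (G i) x))" for x
  have mG: "marginal K (G i) \<in> borel_measurable (Pi\<^sub>M I M)" if "i \<in> I" "K \<subseteq> I" for i K
    using that G I(1) by (intro measurable_marginal) (auto dest: finite_subset)
  have mF: "F \<in> borel_measurable (Pi\<^sub>M I M)"
    unfolding F_def[abs_def] by (intro borel_measurable_prod_ennreal measurable_ennreal_powr mG) auto
  have "finite J" using J I(1) by (rule finite_subset)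
  then have "marginal J F x \<le> (\<Prod>i\<in>I. ennreal_powr p (marginal (insert i J) (G i) x))"
    using J x
  proof (induction J arbitrary: x rule: finite_induct)
    case empty
    then show ?case by (simp add: marginal_empty F_def)
  next
    case (insert j J)
    let ?h = "\<lambda>i t. marginal (insert i J) (G i) (x(j := t))"
    have jI: "j \<in> I" "J \<subseteq> I" using insert.prems by auto
    have card: "card (I - {j}) = card I - 1" using jI(1) I(1) by simp
    have ne: "I - {j} \<noteq> {}" using card I(2) by (metis card.empty diff_is_0_eq not_less_eq_eq numeral_2_eq_2 One_nat_def)
    have mh: "?h i \<in> borel_measurable (M j)" if "i \<in> I" for i
    proof -
      have "(\<lambda>t. x(j := t)) \<in> measurable (M j) (Pi\<^sub>M I M)"
      proof (rule measurable_PiM_single')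
        fix k assume "k \<in> I"
        with insert.prems(2) show "(\<lambda>t. (x(j := t)) k) \<in> measurable (M j) (M k)"
          by (cases "k = j") (auto simp: space_PiM PiE_iff)
      next
        show "(\<lambda>t. x(j := t)) \<in> space (M j) \<rightarrow> (\<Pi>\<^sub>E i\<in>I. space (M i))"
          using fun_upd_in_space_PiM[OF insert.prems(2) jI(1)] by (auto simp: space_PiM)
      qed
      then show ?thesis
        using that jI by (intro measurable_compose[OF _ mG]) auto
    qed
    have "marginal (insert j J) F x = (\<integral>\<^sup>+t. marginal J F (x(j := t)) \<partial>M j)"
      by (rule marginal_insert) (use insert mF in auto)
    also have "\<dots> \<le> (\<integral>\<^sup>+t. (\<Prod>i\<in>I. ennreal_powr p (?h i t)) \<partial>M j)"
      using jI insert.prems(2) by (intro nn_integral_mono insert.IH fun_upd_in_space_PiM)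
    also have "\<dots> = (\<integral>\<^sup>+t. ennreal_powr p (marginal (insert j J) (G j) x) * (\<Prod>i\<in>I - {j}. ennreal_powr p (?h i t)) \<partial>M j)"
      by (simp add: prod.remove[OF I(1) jI(1)] marginal_update)
    also have "\<dots> = ennreal_powr p (marginal (insert j J) (G j) x) * (\<integral>\<^sup>+t. (\<Prod>i\<in>I - {j}. ennreal_powr p (?h i t)) \<partial>M j)"
      by (intro nn_integral_cmult borel_measurable_prod_ennreal measurable_ennreal_powr mh) auto
    also have "\<dots> \<le> ennreal_powr p (marginal (insert j J) (G j) x) * (\<Prod>i\<in>I - {j}. ennreal_powr p (\<integral>\<^sup>+t. ?h i t \<partial>M j))"
      using nn_integral_prod_le_prod_nn_integral[of "I - {j}" ?h "M j"] I(1) ne mh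
      by (intro mult_left_mono) (auto simp: p_def card)
    also have "(\<Prod>i\<in>I - {j}. ennreal_powr p (\<integral>\<^sup>+t. ?h i t \<partial>M j))
        = (\<Prod>i\<in>I - {j}. ennreal_powr p (marginal (insert i (insert j J)) (G i) x))"
    proof (intro prod.cong refl arg_cong[where f = "ennreal_powr p"])
      fix i assume i: "i \<in> I - {j}"
      have "marginal (insert j (insert i J)) (G i) x = (\<integral>\<^sup>+t. ?h i t \<partial>M j)"
        using i insert G by (intro marginal_insert) auto
      then show "(\<integral>\<^sup>+t. ?h i t \<partial>M j) = marginal (insert i (insert j J)) (G i) x"
        by (simp add: insert_commute)
    qed
    also have "ennreal_powr p (marginal (insert j J) (G j) x) * \<dots>
        = (\<Prod>i\<in>I. ennreal_powr p (marginal (insert i (insert j J)) (G i) x))"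
      by (simp add: prod.remove[OF I(1) jI(1)])
    finally show ?case .
  qed
  then show ?thesis by (simp add: F_def[abs_def])
qed

lemma marginal_all:
  assumes "x \<in> space (Pi\<^sub>M I M)"
  shows "marginal I f x = (\<integral>\<^sup>+y. f y \<partial>Pi\<^sub>M I M)"
  unfolding marginal_def
proof (intro nn_integral_cong arg_cong[where f = f])
  fix y assume "y \<in> space (Pi\<^sub>M I M)"
  with assms show "override_on x y I = y"
    by (auto simp: space_PiM PiE_iff extensional_def override_on_def fun_eq_iff)
qed

text \<open>A form of the Loomis--Whitney inequality: the line integral in direction \<open>i\<close> is a
  function of the other variables only.\<close>

lemma nn_integral_prod_line_integrals:
  assumes I: "finite I" "card I \<ge> 2"
    and G: "\<And>i. i \<in> I \<Longrightarrow> G i \<in> borel_measurable (Pi\<^sub>M I M)"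
  defines "p \<equiv> 1 / real (card I - 1)"
  shows "(\<integral>\<^sup>+x. (\<Prod>i\<in>I. ennreal_powr p (\<integral>\<^sup>+t. G i (x(i := t)) \<partial>M i)) \<partial>Pi\<^sub>M I M)
    \<le> (\<Prod>i\<in>I. ennreal_powr p (\<integral>\<^sup>+x. G i x \<partial>Pi\<^sub>M I M))"
proof (cases "space (Pi\<^sub>M I M) = {}")
  case True
  then show ?thesis by (simp add: Nonnegative_Lebesgue_Integration.nn_integral_empty)
next
  case False
  then obtain z where z: "z \<in> space (Pi\<^sub>M I M)" by blast
  have "(\<integral>\<^sup>+x. (\<Prod>i\<in>I. ennreal_powr p (\<integral>\<^sup>+t. G i (x(i := t)) \<partial>M i)) \<partial>Pi\<^sub>M I M)
      = (\<integral>\<^sup>+x. (\<Prod>i\<in>I. ennreal_powr p (marginal {i} (G i) x)) \<partial>Pi\<^sub>M I M)"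
    using G by (intro nn_integral_cong prod.cong refl arg_cong[where f = "ennreal_powr p"])
      (simp add: marginal_insert[where J = "{}"] marginal_empty)
  also have "\<dots> = marginal I (\<lambda>x. \<Prod>i\<in>I. ennreal_powr p (marginal {i} (G i) x)) z"
    by (rule marginal_all[OF z, symmetric])
  also have "\<dots> \<le> (\<Prod>i\<in>I. ennreal_powr p (marginal (insert i I) (G i) z))"
    unfolding p_def by (rule marginal_prod_le[OF I G order_refl z])
  also have "\<dots> = (\<Prod>i\<in>I. ennreal_powr p (\<integral>\<^sup>+x. G i x \<partial>Pi\<^sub>M I M))"
    by (intro prod.cong refl) (simp add: insert_absorb marginal_all[OF z])
  finally show ?thesis .
qed

end


section \<open>The Gagliardo--Nirenberg inequality\<close>

text \<open>Lebesgue measure is the image of a product measure indexed by the basis, and changing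
  the coordinate \<open>b\<close> to \<open>t\<close> means moving along the line \<open>x + (t - x \<bullet> b) b\<close>.\<close>

lemma nn_integral_prod_line_integrals_lborel:
  fixes g :: "'a::euclidean_space \<Rightarrow> 'a \<Rightarrow> ennreal"
  assumes dim: "DIM('a) \<ge> 2" and g[measurable]: "\<And>b. b \<in> Basis \<Longrightarrow> g b \<in> borel_measurable borel"
  defines "p \<equiv> 1 / real (DIM('a) - 1)"
  shows "(\<integral>\<^sup>+x. (\<Prod>b\<in>Basis. ennreal_powr p (\<integral>\<^sup>+t. g b (x + (t - x \<bullet> b) *\<^sub>R b) \<partial>lborel)) \<partial>lborel)
    \<le> (\<Prod>b\<in>Basis. ennreal_powr p (\<integral>\<^sup>+x. g b x \<partial>lborel))"
proof -
  interpret product_sigma_finite "\<lambda>_::'a. lborel :: real measure"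
    by standard
  let ?P = "\<Pi>\<^sub>M b\<in>(Basis::'a set). (lborel :: real measure)"
  define S where "S f = (\<Sum>b\<in>Basis. f b *\<^sub>R b)" for f :: "'a \<Rightarrow> real"
  have S[measurable]: "S \<in> borel_measurable ?P"
    unfolding S_def[abs_def] by measurable
  have lb: "(lborel :: 'a measure) = distr ?P borel S"
    unfolding S_def[abs_def] by (rule lborel_eq)
  have I: "(\<integral>\<^sup>+x. h x \<partial>lborel) = (\<integral>\<^sup>+f. h (S f) \<partial>?P)"
    if "h \<in> borel_measurable borel" for h :: "'a \<Rightarrow> ennreal"
    unfolding lb using that by (subst nn_integral_distr) auto
  have S_inner: "S f \<bullet> b = f b" if "b \<in> Basis" for f b
    using that by (simp add: S_def inner_sum_left inner_Basis if_distrib cong: if_cong)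
  have S_upd: "S (f(b := t)) = S f + (t - S f \<bullet> b) *\<^sub>R b" if b: "b \<in> Basis" for f b t
    by (rule euclidean_eqI) (use b in \<open>auto simp: S_inner inner_add_left inner_Basis\<close>)
  have "(\<lambda>x. \<integral>\<^sup>+t. g b (x + (t - x \<bullet> b) *\<^sub>R b) \<partial>lborel) \<in> borel_measurable borel"
    if "b \<in> Basis" for b
    using g[OF that] by measurable
  then have "(\<integral>\<^sup>+x. (\<Prod>b\<in>Basis. ennreal_powr p (\<integral>\<^sup>+t. g b (x + (t - x \<bullet> b) *\<^sub>R b) \<partial>lborel)) \<partial>lborel)
      = (\<integral>\<^sup>+f. (\<Prod>b\<in>Basis. ennreal_powr p (\<integral>\<^sup>+t. g b (S f + (t - S f \<bullet> b) *\<^sub>R b) \<partial>lborel)) \<partial>?P)"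
    by (intro I borel_measurable_prod_ennreal measurable_ennreal_powr)
  also have "\<dots> = (\<integral>\<^sup>+f. (\<Prod>b\<in>Basis. ennreal_powr p (\<integral>\<^sup>+t. g b (S (f(b := t))) \<partial>lborel)) \<partial>?P)"
    by (simp add: S_upd cong: prod.cong)
  also have "\<dots> \<le> (\<Prod>b\<in>Basis. ennreal_powr p (\<integral>\<^sup>+f. g b (S f) \<partial>?P))"
    unfolding p_def using dim
    by (intro nn_integral_prod_line_integrals) auto
  also have "\<dots> = (\<Prod>b\<in>Basis. ennreal_powr p (\<integral>\<^sup>+x. g b x \<partial>lborel))"
    by (simp add: I cong: prod.cong)
  finally show ?thesis .
qed

text \<open>The fundamental theorem of calculus, started at a point to the left of the support.\<close>

lemma abs_le_nn_integral_abs_deriv: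
  fixes \<phi> \<phi>' :: "real \<Rightarrow> real"
  assumes deriv: "\<And>t. (\<phi> has_real_derivative \<phi>' t) (at t)" and cont: "continuous_on UNIV \<phi>'"
    and bdd: "bounded {t. \<phi> t \<noteq> 0}"
  shows "ennreal \<bar>\<phi> s\<bar> \<le> (\<integral>\<^sup>+t. ennreal \<bar>\<phi>' t\<bar> \<partial>lborel)"
proof -
  obtain B where B: "\<And>t. \<phi> t \<noteq> 0 \<Longrightarrow> \<bar>t\<bar> \<le> B"
    using bdd by (auto simp: bounded_iff)
  \<comment> \<open>The absolute value covers the case of an identically vanishing function, where the
    bound \<open>B\<close> may be negative.\<close>
  define a where "a = min s (- \<bar>B\<bar> - 1)"
  have a: "a \<le> s" "\<phi> a = 0"
    using B[of a] by (force simp: a_def)+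
  have *: "has_bochner_integral lborel (\<lambda>t. \<phi>' t * indicator {a..s} t) (\<phi> s - \<phi> a)"
    using cont by (intro has_bochner_integral_FTC_Icc_real a deriv) (auto simp: continuous_on_eq_continuous_at)
  have "ennreal \<bar>\<phi> s\<bar> \<le> (\<integral>\<^sup>+t. norm (\<phi>' t * indicator {a..s} t) \<partial>lborel)"
    using has_bochner_integral_norm_bound[OF *] a by simp
  also have "\<dots> \<le> (\<integral>\<^sup>+t. ennreal \<bar>\<phi>' t\<bar> \<partial>lborel)"
    by (intro nn_integral_mono) (auto split: split_indicator)
  finally show ?thesis .
qed

text \<open>The exponent \<open>n/(n-1)\<close> is \<open>n\<close> times \<open>1/(n-1)\<close>, so the power of \<open>|v x|\<close> is a product
  with one factor per direction, each of which is bounded by the line integral in its own direction.\<close>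

lemma Gagliardo_Nirenberg:
  fixes v :: "'a::euclidean_space \<Rightarrow> real"
  assumes dim: "DIM('a) \<ge> 2"
    and deriv: "\<And>x. (v has_derivative D x) (at x)"
    and cont: "\<And>b. b \<in> Basis \<Longrightarrow> continuous_on UNIV (\<lambda>x. D x b)"
    and bdd: "bounded {x. v x \<noteq> 0}"
  defines "n \<equiv> real DIM('a)"
  shows "(\<integral>\<^sup>+x. ennreal (\<bar>v x\<bar> powr (n / (n - 1))) \<partial>lborel)
    \<le> (\<Prod>b\<in>Basis. ennreal_powr (1 / (n - 1)) (\<integral>\<^sup>+x. ennreal \<bar>D x b\<bar> \<partial>lborel))"
proof -
  define p where "p = 1 / real (DIM('a) - 1)"
  have p: "p = 1 / (n - 1)" "p \<ge> 0" "n / (n - 1) = n * p"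
    using dim by (auto simp: p_def n_def of_nat_diff)
  let ?l = "\<lambda>b x. \<integral>\<^sup>+t. ennreal \<bar>D (x + (t - x \<bullet> b) *\<^sub>R b) b\<bar> \<partial>lborel"
  have line: "ennreal \<bar>v x\<bar> \<le> ?l b x" if b: "b \<in> Basis" for b x
  proof -
    let ?c = "\<lambda>t. x + (t - x \<bullet> b) *\<^sub>R b"
    have "ennreal \<bar>v (?c (x \<bullet> b))\<bar> \<le> (\<integral>\<^sup>+t. ennreal \<bar>D (?c t) b\<bar> \<partial>lborel)"
    proof (rule abs_le_nn_integral_abs_deriv[where \<phi> = "\<lambda>t. v (?c t)"])
      fix t
      have "(?c has_derivative (\<lambda>h. h *\<^sub>R b)) (at t)"
        by (auto intro!: derivative_eq_intros)
      from diff_chain_at[OF this deriv]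
      have "((\<lambda>t. v (?c t)) has_derivative (\<lambda>h. D (?c t) (h *\<^sub>R b))) (at t)"
        by (simp add: o_def)
      moreover have "(\<lambda>h. D (?c t) (h *\<^sub>R b)) = (*) (D (?c t) b)"
        using linear_scale[OF has_derivative_linear[OF deriv]] by (auto simp: fun_eq_iff)
      ultimately show "((\<lambda>t. v (?c t)) has_real_derivative D (?c t) b) (at t)"
        by (simp add: has_field_derivative_def)
    next
      show "continuous_on UNIV (\<lambda>t. D (?c t) b)"
        by (rule continuous_on_compose2[OF cont[OF b]]) (auto intro!: continuous_intros)
    next
      obtain B where B: "\<And>y. v y \<noteq> 0 \<Longrightarrow> norm y \<le> B"
        using bdd by (auto simp: bounded_iff)
      have "\<bar>t\<bar> \<le> B" if "v (?c t) \<noteq> 0" for t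
      proof -
        have "\<bar>?c t \<bullet> b\<bar> \<le> norm (?c t)" using b by (rule Basis_le_norm)
        also have "?c t \<bullet> b = t" using b by (simp add: inner_add_left)
        finally show ?thesis using B[OF that] by simp
      qed
      then show "bounded {t. v (?c t) \<noteq> 0}" by (auto simp: bounded_iff)
    qed
    then show ?thesis by simp
  qed
  have "(\<integral>\<^sup>+x. ennreal (\<bar>v x\<bar> powr (n / (n - 1))) \<partial>lborel)
      = (\<integral>\<^sup>+x. (\<Prod>b\<in>(Basis::'a set). ennreal_powr p (ennreal \<bar>v x\<bar>)) \<partial>lborel)"
  proof (intro nn_integral_cong)
    fix x
    have "(\<bar>v x\<bar> powr p) ^ DIM('a) = \<bar>v x\<bar> powr (n / (n - 1))"
      using powr_power[of "\<bar>v x\<bar>" p "DIM('a)"] p(3) by (cases "v x = 0") (simp_all add: n_def)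
    then show "ennreal (\<bar>v x\<bar> powr (n / (n - 1))) = (\<Prod>b\<in>(Basis::'a set). ennreal_powr p (ennreal \<bar>v x\<bar>))"
      by (simp add: ennreal_power)
  qed
  also have "\<dots> \<le> (\<integral>\<^sup>+x. (\<Prod>b\<in>Basis. ennreal_powr p (?l b x)) \<partial>lborel)"
    by (intro nn_integral_mono prod_mono_ennreal ennreal_powr_mono p line)
  also have "\<dots> \<le> (\<Prod>b\<in>Basis. ennreal_powr p (\<integral>\<^sup>+x. ennreal \<bar>D x b\<bar> \<partial>lborel))"
    unfolding p_def using cont
    by (intro nn_integral_prod_line_integrals_lborel dim measurable_compose[OF _ measurable_ennreal]
      borel_measurable_abs borel_measurable_continuous_onI)
  finally show ?thesis by (simp add: p(1))
qed


section \<open>The weight and the volume of the hyperboloid\<close>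

lemma hyp_weight_pos: "\<tau> > 0 \<Longrightarrow> hyp_weight \<tau> x > 0"
  by (simp add: hyp_weight_def add_pos_nonneg)

lemma abs_component_le_hyp_weight: "\<bar>x $ i\<bar> \<le> hyp_weight \<tau> x"
proof -
  have "\<bar>x $ i\<bar> \<le> norm x" by (rule component_le_norm_cart)
  also have "\<dots> \<le> hyp_weight \<tau> x"
    unfolding hyp_weight_def by (rule real_le_rsqrt) simp
  finally show ?thesis .
qed

lemma continuous_on_hyp_weight [continuous_intros]: "continuous_on S (hyp_weight \<tau>)"
  unfolding hyp_weight_def[abs_def] by (intro continuous_intros)

lemma has_derivative_hyp_weight_powr:
  assumes "\<tau> > 0"
  shows "((\<lambda>x. hyp_weight \<tau> x powr \<alpha>) has_derivative
    (\<lambda>h. \<alpha> * hyp_weight \<tau> x powr (\<alpha> - 1) * (x \<bullet> h / hyp_weight \<tau> x))) (at x)"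
proof -
  have hw: "hyp_weight \<tau> = (\<lambda>y. sqrt (\<tau>\<^sup>2 + y \<bullet> y))"
    by (simp add: fun_eq_iff hyp_weight_def power2_norm_eq_inner)
  have pos: "\<tau>\<^sup>2 + x \<bullet> x > 0"
    using assms by (simp add: add_pos_nonneg)
  have "(hyp_weight \<tau> has_derivative (\<lambda>h. x \<bullet> h / hyp_weight \<tau> x)) (at x)"
    unfolding hw using pos
    by (auto intro!: derivative_eq_intros simp: fun_eq_iff field_simps inner_commute)
  from DERIV_compose_FDERIV[OF has_real_derivative_powr[OF hyp_weight_pos[OF assms, of x]] this]
  show ?thesis by (simp add: mult.commute)
qed

lemma smooth_fun_imp_C1:
  assumes "smooth_fun u"
  shows "u differentiable at x" "continuous_on S u" "continuous_on S (partial_deriv i u)"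
proof -
  have "times_cont_diff 1 u" "times_cont_diff 0 u"
    using assms by (simp_all add: smooth_fun_def del: times_cont_diff.simps)
  then show "u differentiable at x" "continuous_on S u" "continuous_on S (partial_deriv i u)"
    by (auto intro: continuous_on_subset)
qed

lemma partial_deriv_eq_0_outside_support:
  assumes "x \<notin> closure {x. u x \<noteq> 0}"
  shows "partial_deriv i u x = 0"
proof -
  have "(u has_derivative (\<lambda>h. 0)) (at x)"
  proof (rule has_derivative_transform_within_open)
    show "((\<lambda>x. 0) has_derivative (\<lambda>h. 0)) (at x)" by simp
    show "open (- closure {x. u x \<noteq> 0})" by auto
    show "x \<in> - closure {x. u x \<noteq> 0}" using assms by simp
    show "0 = u y" if "y \<in> - closure {x. u x \<noteq> 0}" for y
      using that closure_subset[of "{x. u x \<noteq> 0}"] by auto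
  qed
  then show ?thesis
    by (simp add: partial_deriv_def frechet_derivative_at[symmetric])
qed

lemma integral_hyp_vol:
  assumes "\<tau> > 0" and [measurable]: "f \<in> borel_measurable borel"
  shows "(\<integral>x. f x \<partial>hyp_vol \<tau>) = (\<integral>x. \<tau> / hyp_weight \<tau> x * f x \<partial>lborel)"
proof -
  have [measurable]: "hyp_weight \<tau> \<in> borel_measurable borel"
    by (intro borel_measurable_continuous_onI continuous_intros)
  show ?thesis
    unfolding hyp_vol_def using assms
    by (subst integral_density) (auto intro!: AE_I2 divide_nonneg_pos hyp_weight_pos)
qed

lemma prod_Basis_cart:
  fixes f :: "real ^ 'n \<Rightarrow> 'b::comm_monoid_mult"
  shows "(\<Prod>b\<in>Basis. f b) = (\<Prod>i\<in>UNIV. f (axis i 1))"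
proof -
  have "inj (\<lambda>i. axis i (1::real) :: real ^ 'n)"
    by (auto simp: inj_on_def axis_eq_axis)
  moreover have "Basis = range (\<lambda>i. axis i (1::real) :: real ^ 'n)"
    by (auto simp: Basis_vec_def)
  ultimately show ?thesis
    using prod.reindex[of "\<lambda>i. axis i (1::real) :: real ^ 'n" UNIV f] by (simp add: comp_def)
qed

section \<open>The weighted inequality on the hyperboloid\<close>

theorem mainTheorem1:
  fixes \<tau> \<alpha> d :: real and u :: "real ^ 'n::finite \<Rightarrow> real"
  assumes dim: "CARD('n) \<ge> 2"
    and d: "d = real CARD('n)"
    and tau: "\<tau> > 0"
    and smooth: "smooth_fun u"
    and supp: "compact_support u"
  shows "\<tau> powr (1 / (d - 1)) *
      (\<integral>x. hyp_weight \<tau> x powr (1 + \<alpha> * (d / (d - 1))) * \<bar>u x\<bar> powr (d / (d - 1)) \<partial>hyp_vol \<tau>)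
    \<le> (\<Prod>i\<in>UNIV.
        (\<integral>x. hyp_weight \<tau> x powr \<alpha> * \<bar>hyp_boost \<tau> i u x\<bar>
             + \<bar>\<alpha>\<bar> * hyp_weight \<tau> x powr \<alpha> * \<bar>u x\<bar> \<partial>hyp_vol \<tau>) powr (1 / (d - 1)))"
proof -
  let ?w = "hyp_weight \<tau> :: real ^ 'n \<Rightarrow> real"
  define v where "v x = ?w x powr \<alpha> * u x" for x
  define G where "G i x = ?w x powr \<alpha> * \<bar>partial_deriv i u x\<bar> + \<bar>\<alpha>\<bar> * ?w x powr (\<alpha> - 1) * \<bar>u x\<bar>" for i x
  define D where "D x h = ?w x powr \<alpha> * frechet_derivative u (at x) h
    + \<alpha> * ?w x powr (\<alpha> - 1) * (x \<bullet> h / ?w x) * u x" for x h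
  define K where "K = closure {x. u x \<noteq> 0}"
  have d1: "d > 1" using dim d by simp
  note w = hyp_weight_pos[OF tau]
  note C1 = smooth_fun_imp_C1[OF smooth]
  have w0: "?w x \<noteq> 0" for x using w[of x] by simp
  have u0: "u x = 0" if "x \<notin> K" for x
    using that closure_subset[of "{x. u x \<noteq> 0}"] by (auto simp: K_def)
  have K: "compact K" using supp by (simp add: K_def compact_support_def)

  have D_axis: "D x (axis i 1) = ?w x powr \<alpha> * partial_deriv i u x
      + \<alpha> * ?w x powr (\<alpha> - 1) * (x $ i / ?w x) * u x" for x i
    by (simp add: D_def partial_deriv_def inner_axis)
  have D_le: "\<bar>D x (axis i 1)\<bar> \<le> G i x" for x i
  proof -
    have "\<bar>D x (axis i 1)\<bar> \<le> \<bar>?w x powr \<alpha> * partial_deriv i u x\<bar>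
        + \<bar>\<alpha> * ?w x powr (\<alpha> - 1) * (x $ i / ?w x) * u x\<bar>"
      unfolding D_axis by (rule abs_triangle_ineq)
    also have "\<dots> = ?w x powr \<alpha> * \<bar>partial_deriv i u x\<bar>
        + \<bar>\<alpha>\<bar> * ?w x powr (\<alpha> - 1) * \<bar>u x\<bar> * (\<bar>x $ i\<bar> / ?w x)"
      using w[of x] by (simp add: abs_mult)
    also have "\<dots> \<le> ?w x powr \<alpha> * \<bar>partial_deriv i u x\<bar>
        + \<bar>\<alpha>\<bar> * ?w x powr (\<alpha> - 1) * \<bar>u x\<bar> * 1"
      using w[of x] abs_component_le_hyp_weight[of x i \<tau>] by (intro add_left_mono mult_left_mono) auto
    finally show ?thesis by (simp add: G_def)
  qed
  have v_deriv: "(v has_derivative D x) (at x)" for x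
  proof -
    have "(u has_derivative frechet_derivative u (at x)) (at x)"
      using C1(1) by (simp add: frechet_derivative_works)
    from has_derivative_mult[OF has_derivative_hyp_weight_powr[OF tau] this]
    show ?thesis by (simp add: v_def[abs_def] D_def[abs_def])
  qed
  have v_bdd: "bounded {x. v x \<noteq> 0}"
    by (rule bounded_subset[OF compact_imp_bounded[OF K]]) (use u0 in \<open>auto simp: v_def\<close>)
  have D_cont: "continuous_on UNIV (\<lambda>x. D x (axis i 1))" for i
    unfolding D_axis by (intro continuous_intros C1 ballI w0)
  have D_cont': "continuous_on UNIV (\<lambda>x. D x b)" if "b \<in> Basis" for b
    using that D_cont by (auto simp: Basis_vec_def)
  have G_cont: "continuous_on UNIV (G i)" for i
    unfolding G_def[abs_def] by (intro continuous_intros C1 ballI w0)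
  have G_nn: "0 \<le> G i x" for i x by (simp add: G_def)
  have G_int: "integrable lborel (G i)" for i
  proof -
    have "integrable lborel (\<lambda>x. indicator K x *\<^sub>R G i x)"
      using K continuous_on_subset[OF G_cont] by (intro borel_integrable_compact) auto
    also have "(\<lambda>x. indicator K x *\<^sub>R G i x) = G i"
    proof
      show "indicator K x *\<^sub>R G i x = G i x" for x
        using u0[of x] partial_deriv_eq_0_outside_support[of x u i]
        by (cases "x \<in> K") (simp_all add: G_def K_def)
    qed
    finally show ?thesis .
  qed

  define B where "B i = (\<integral>x. G i x \<partial>lborel)" for i
  have B_nn: "0 \<le> B i" for i by (simp add: B_def G_nn)
  have "(\<integral>\<^sup>+x. ennreal (\<bar>v x\<bar> powr (d / (d - 1))) \<partial>lborel)
      \<le> (\<Prod>i\<in>UNIV. ennreal_powr (1 / (d - 1)) (\<integral>\<^sup>+x. ennreal \<bar>D x (axis i 1)\<bar> \<partial>lborel))"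
    using Gagliardo_Nirenberg[OF _ v_deriv D_cont' v_bdd] dim by (simp add: prod_Basis_cart d)
  also have "\<dots> \<le> (\<Prod>i\<in>UNIV. ennreal_powr (1 / (d - 1)) (\<integral>\<^sup>+x. ennreal (G i x) \<partial>lborel))"
    using d1 by (intro prod_mono_ennreal ennreal_powr_mono nn_integral_mono ennreal_leI D_le) auto
  also have "\<dots> = ennreal (\<Prod>i\<in>UNIV. B i powr (1 / (d - 1)))"
    by (simp add: nn_integral_eq_integral[OF G_int] G_nn B_nn B_def[symmetric] prod_ennreal)
  finally have main: "(\<integral>\<^sup>+x. ennreal (\<bar>v x\<bar> powr (d / (d - 1))) \<partial>lborel)
      \<le> ennreal (\<Prod>i\<in>UNIV. B i powr (1 / (d - 1)))" .
  have v_cont: "continuous_on UNIV v"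
    unfolding v_def[abs_def] by (intro continuous_intros C1 ballI w0)
  then have [measurable]: "v \<in> borel_measurable borel"
    by (rule borel_measurable_continuous_onI)
  have "(\<integral>x. \<bar>v x\<bar> powr (d / (d - 1)) \<partial>lborel)
      = enn2real (\<integral>\<^sup>+x. ennreal (\<bar>v x\<bar> powr (d / (d - 1))) \<partial>lborel)"
    by (rule integral_eq_nn_integral) auto
  also have "\<dots> \<le> (\<Prod>i\<in>UNIV. B i powr (1 / (d - 1)))"
    by (rule enn2real_leI[OF prod_nonneg main]) simp
  finally have GN: "(\<integral>x. \<bar>v x\<bar> powr (d / (d - 1)) \<partial>lborel) \<le> (\<Prod>i\<in>UNIV. B i powr (1 / (d - 1)))" .

  have [measurable]: "?w \<in> borel_measurable borel" "u \<in> borel_measurable borel"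
      "partial_deriv i u \<in> borel_measurable borel" for i
    by (intro borel_measurable_continuous_onI continuous_intros C1)+
  have lhs: "(\<integral>x. ?w x powr (1 + \<alpha> * (d / (d - 1))) * \<bar>u x\<bar> powr (d / (d - 1)) \<partial>hyp_vol \<tau>)
      = \<tau> * (\<integral>x. \<bar>v x\<bar> powr (d / (d - 1)) \<partial>lborel)"
  proof -
    have "\<tau> / ?w x * (?w x powr (1 + \<alpha> * (d / (d - 1))) * \<bar>u x\<bar> powr (d / (d - 1)))
        = \<tau> * \<bar>v x\<bar> powr (d / (d - 1))" for x
      using w[of x] by (simp add: v_def abs_mult powr_mult powr_powr powr_add)
    then show ?thesis
      by (subst integral_hyp_vol[OF tau]) simp_all
  qed
  have rhs: "(\<integral>x. ?w x powr \<alpha> * \<bar>hyp_boost \<tau> i u x\<bar> + \<bar>\<alpha>\<bar> * ?w x powr \<alpha> * \<bar>u x\<bar> \<partial>hyp_vol \<tau>)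
      = \<tau> * B i" for i
  proof -
    have "\<tau> / ?w x * (?w x powr \<alpha> * \<bar>hyp_boost \<tau> i u x\<bar> + \<bar>\<alpha>\<bar> * ?w x powr \<alpha> * \<bar>u x\<bar>) = \<tau> * G i x" for x
      using w[of x] by (simp add: G_def hyp_boost_def abs_mult powr_diff field_simps)
    then show ?thesis
      unfolding hyp_boost_def
      by (subst integral_hyp_vol[OF tau]) (simp_all add: B_def)
  qed
  \<comment> \<open>The powers of \<open>\<tau>\<close> balance: the volume form gives one factor \<open>\<tau>\<close> on the left, and
    on the right a factor \<open>\<tau>\<close> in each of the \<open>d\<close> integrals, which are raised to \<open>1/(d-1)\<close>.\<close>
  have "\<tau> powr (1 / (d - 1)) * \<tau> = \<tau> powr (1 / (d - 1) + 1)"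
    using tau by (simp add: powr_add)
  also have "1 / (d - 1) + 1 = d * (1 / (d - 1))"
    using d1 by (simp add: field_simps)
  also have "\<tau> powr (d * (1 / (d - 1))) = (\<Prod>i\<in>(UNIV::'n set). \<tau> powr (1 / (d - 1)))"
    using tau by (simp add: d powr_power)
  finally have scale: "\<tau> powr (1 / (d - 1)) * \<tau> = (\<Prod>i\<in>(UNIV::'n set). \<tau> powr (1 / (d - 1)))" .
  have "\<tau> powr (1 / (d - 1)) * (\<tau> * (\<integral>x. \<bar>v x\<bar> powr (d / (d - 1)) \<partial>lborel))
      \<le> (\<Prod>i\<in>(UNIV::'n set). \<tau> powr (1 / (d - 1))) * (\<Prod>i\<in>UNIV. B i powr (1 / (d - 1)))"
    unfolding mult.assoc[symmetric] scale by (intro mult_left_mono GN prod_nonneg) simp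
  also have "\<dots> = (\<Prod>i\<in>UNIV. (\<tau> * B i) powr (1 / (d - 1)))"
    using tau B_nn by (simp add: powr_mult prod.distrib)
  finally show ?thesis
    unfolding lhs rhs .
qed

end
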